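(* Let $(A,\bullet)$ be a mock-Lie algebra. Suppose that there is a mock-Lie algebra structure $\diamond$ on $A^*$ which is given by a linear map $\Delta:A\to A\otimes A$, i.e. $\xi\diamond\eta=\Delta^*(\xi\otimes\eta)$ for all $\xi,\eta\in A^*$. Let $L^*$ and $\mathcal{L}^*$ be the coadjoint representations of $(A,\bullet)$ on $A^*$ and of $(A^*,\diamond)$ on $A$. Then the following conditions are equivalent: (1) $(A\oplus A^*,A,A^* )$ is a standard Manin triple of mock-Lie algebras with respect to the bilinear form $\omega_d(x+\xi,y+\eta)=\langle x,\eta\rangle+\langle\xi,y\rangle$; that is, there is a mock-Lie algebra structure on $A\oplus A^*$ such that $(A,\bullet)$ and $(A^*,\diamond)$ are subalgebras and $\omega_d$ is invariant. (2) $(A,A^*;L^*,\mathcal{L}^* )$ is a matched pair of mock-Lie algebras. (3) $(A,A^* )$ (i.e. $(A,\Delta)$) is a mock-Lie bialgebra.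
   Context: All vector spaces are finite-dimensional over a field $\mathbb{K}$ of characteristic zero. A mock-Lie algebra $(A,\bullet)$ is a vector space with a bilinear product that is commutative and satisfies $x\bullet(y\bullet z)+y\bullet(z\bullet x)+z\bullet(x\bullet y)=0$. A bilinear form $\omega$ on $A$ is invariant if $\omega(x\bullet y,z)=\omega(x,y\bullet z)$ for all $x,y,z$. A representation of $(A,\bullet)$ is a vector space $V$ with a linear map $\rho:A\to\mathrm{End}(V)$ such that $\rho(x\bullet y)=-\rho(x)\rho(y)-\rho(y)\rho(x)$. $L(x)y=x\bullet y$, and $L^*:A\to\mathrm{End}(A^* )$ is defined by $\langle L^*(x)\xi,y\rangle=\langle\xi,x\bullet y\rangle$. Similarly $\mathcal{L}(\xi)\eta=\xi\diamond\eta$ and $\mathcal{L}^*:A^*\to\mathrm{End}(A)$ is defined by $\langle\mathcal{L}^*(\xi)x,\eta\rangle=\langle x,\xi\diamond\eta\rangle$ (identifying $A^{**}=A$). The map $\Delta^*:A^*\otimes A^*\to A^*$ is given by $\langle\Delta^*(\xi\otimes\eta),x\rangle=\langle\xi\otimes\eta,\Delta(x)\rangle$. A matched pair $(A,H;\rho,\mu)$ consists of mock-Lie algebras $(A,\bullet)$, $(H,\diamond)$ and representations $\rho:A\to\mathrm{End}(H)$ of $A$ and $\mu:H\to\mathrm{End}(A)$ of $H$ such that for all $x,y\in A$, $a,b\in H$: $\rho(x)(a\diamond b)+\rho(x)a\diamond b+a\diamond\rho(x)b+\rho(\mu(a)x)b+\rho(\mu(b)x)a=0$ and $\mu(a)(x\bullet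 y)+\mu(a)x\bullet y+x\bullet\mu(a)y+\mu(\rho(x)a)y+\mu(\rho(y)a)x=0$. A mock-Lie bialgebra structure on $(A,\bullet)$ is a symmetric linear map $\Delta:A\to A\otimes A$ (i.e. $\tau\circ\Delta=\Delta$, where $\tau$ is the flip) such that $\Delta^*$ defines a mock-Lie algebra structure on $A^*$ and, for all $x,y\in A$, $$\Delta(x\bullet y)=-(L(x)\otimes\mathrm{id}+\mathrm{id}\otimes L(x))\Delta(y)-(L(y)\otimes\mathrm{id}+\mathrm{id}\otimes L(y))\Delta(x).$$ It is denoted $(A,\Delta)$ or $(A,A^* )$. *)

theory Defs
  imports Complex_Main "HOL-Library.Function_Algebras" "HOL-Library.Product_Plus"
begin

section \<open>Vector spaces and linear maps on carriers\<close>

text \<open>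
  The dual \<open>A\<^sup>*\<close>, the tensor square \<open>A \<otimes> A\<close> and the direct sum \<open>A \<oplus> A\<^sup>*\<close> of a vector space
  \<open>A\<close> over \<open>\<bbbK>\<close> are realised as subspaces of ambient vector spaces of functions or pairs, so the
  algebraic notions below carry an explicit carrier. The space \<open>A\<close> itself is the whole type
  \<^typ>\<open>'a\<close>, with scalar multiplication \<open>scale\<close>.
\<close>

definition fd_space :: "('k::field \<Rightarrow> 'v::ab_group_add \<Rightarrow> 'v) \<Rightarrow> 'v set \<Rightarrow> bool" where
  "fd_space s V \<longleftrightarrow> vector_space s \<and> (\<exists>B. finite B \<and> V = module.span s B)"

definition linear_map ::
  "('k::field \<Rightarrow> 'v::ab_group_add \<Rightarrow> 'v) \<Rightarrow> 'v set \<Rightarrow> ('k \<Rightarrow> 'w::ab_group_add \<Rightarrow> 'w) \<Rightarrow> 'w set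
    \<Rightarrow> ('v \<Rightarrow> 'w) \<Rightarrow> bool" where
  "linear_map s V t W f \<longleftrightarrow>
     (\<forall>x\<in>V. f x \<in> W) \<and>
     (\<forall>x\<in>V. \<forall>y\<in>V. f (x + y) = f x + f y) \<and>
     (\<forall>c. \<forall>x\<in>V. f (s c x) = t c (f x))"

definition bilinear_map ::
  "('k::field \<Rightarrow> 'u::ab_group_add \<Rightarrow> 'u) \<Rightarrow> 'u set \<Rightarrow> ('k \<Rightarrow> 'v::ab_group_add \<Rightarrow> 'v) \<Rightarrow> 'v set
    \<Rightarrow> ('k \<Rightarrow> 'w::ab_group_add \<Rightarrow> 'w) \<Rightarrow> 'w set \<Rightarrow> ('u \<Rightarrow> 'v \<Rightarrow> 'w) \<Rightarrow> bool" where
  "bilinear_map r U s V t W f \<longleftrightarrow>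
     (\<forall>x\<in>U. linear_map s V t W (f x)) \<and>
     (\<forall>y\<in>V. linear_map r U t W (\<lambda>x. f x y))"

definition fun_scale :: "'k::times \<Rightarrow> ('x \<Rightarrow> 'k) \<Rightarrow> 'x \<Rightarrow> 'k" where
  "fun_scale c f = (\<lambda>x. c * f x)"

definition prod_scale :: "('k \<Rightarrow> 'v \<Rightarrow> 'v) \<Rightarrow> ('k \<Rightarrow> 'w \<Rightarrow> 'w) \<Rightarrow> 'k \<Rightarrow> 'v \<times> 'w \<Rightarrow> 'v \<times> 'w" where
  "prod_scale s t c p = (s c (fst p), t c (snd p))"

definition dual_space :: "('k::field \<Rightarrow> 'a::ab_group_add \<Rightarrow> 'a) \<Rightarrow> ('a \<Rightarrow> 'k) set" where
  "dual_space scale = {\<xi>. Vector_Spaces.linear scale (*) \<xi>}"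


section \<open>Mock-Lie algebras, representations, matched pairs\<close>

definition mock_Lie_algebra ::
  "('k::field \<Rightarrow> 'v::ab_group_add \<Rightarrow> 'v) \<Rightarrow> 'v set \<Rightarrow> ('v \<Rightarrow> 'v \<Rightarrow> 'v) \<Rightarrow> bool" where
  "mock_Lie_algebra s V m \<longleftrightarrow>
     fd_space s V \<and>
     bilinear_map s V s V s V m \<and>
     (\<forall>x\<in>V. \<forall>y\<in>V. m x y = m y x) \<and>
     (\<forall>x\<in>V. \<forall>y\<in>V. \<forall>z\<in>V. m x (m y z) + m y (m z x) + m z (m x y) = 0)"

definition invariant_form :: "'v set \<Rightarrow> ('v \<Rightarrow> 'v \<Rightarrow> 'v) \<Rightarrow> ('v \<Rightarrow> 'v \<Rightarrow> 'k) \<Rightarrow> bool" where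
  "invariant_form V m \<omega> \<longleftrightarrow> (\<forall>x\<in>V. \<forall>y\<in>V. \<forall>z\<in>V. \<omega> (m x y) z = \<omega> x (m y z))"

text \<open>A linear map \<open>\<rho> : A \<rightarrow> End(V)\<close> is given in curried form, as a bilinear map \<open>A \<times> V \<rightarrow> V\<close>.\<close>

definition mock_Lie_representation ::
  "('k::field \<Rightarrow> 'a::ab_group_add \<Rightarrow> 'a) \<Rightarrow> 'a set \<Rightarrow> ('a \<Rightarrow> 'a \<Rightarrow> 'a)
    \<Rightarrow> ('k \<Rightarrow> 'v::ab_group_add \<Rightarrow> 'v) \<Rightarrow> 'v set \<Rightarrow> ('a \<Rightarrow> 'v \<Rightarrow> 'v) \<Rightarrow> bool" where
  "mock_Lie_representation s A m t V \<rho> \<longleftrightarrow>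
     fd_space t V \<and>
     bilinear_map s A t V t V \<rho> \<and>
     (\<forall>x\<in>A. \<forall>y\<in>A. \<forall>v\<in>V. \<rho> (m x y) v = - \<rho> x (\<rho> y v) - \<rho> y (\<rho> x v))"

definition matched_pair ::
  "('k::field \<Rightarrow> 'a::ab_group_add \<Rightarrow> 'a) \<Rightarrow> 'a set \<Rightarrow> ('a \<Rightarrow> 'a \<Rightarrow> 'a)
    \<Rightarrow> ('k \<Rightarrow> 'h::ab_group_add \<Rightarrow> 'h) \<Rightarrow> 'h set \<Rightarrow> ('h \<Rightarrow> 'h \<Rightarrow> 'h)
    \<Rightarrow> ('a \<Rightarrow> 'h \<Rightarrow> 'h) \<Rightarrow> ('h \<Rightarrow> 'a \<Rightarrow> 'a) \<Rightarrow> bool" where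
  "matched_pair s A m t H d \<rho> \<mu> \<longleftrightarrow>
     mock_Lie_algebra s A m \<and>
     mock_Lie_algebra t H d \<and>
     mock_Lie_representation s A m t H \<rho> \<and>
     mock_Lie_representation t H d s A \<mu> \<and>
     (\<forall>x\<in>A. \<forall>a\<in>H. \<forall>b\<in>H.
        \<rho> x (d a b) + d (\<rho> x a) b + d a (\<rho> x b) + \<rho> (\<mu> a x) b + \<rho> (\<mu> b x) a = 0) \<and>
     (\<forall>x\<in>A. \<forall>y\<in>A. \<forall>a\<in>H.
        \<mu> a (m x y) + m (\<mu> a x) y + m x (\<mu> a y) + \<mu> (\<rho> x a) y + \<mu> (\<rho> y a) x = 0)"


section \<open>Coadjoint actions\<close>

definition coadj :: "('a \<Rightarrow> 'a \<Rightarrow> 'a) \<Rightarrow> 'a \<Rightarrow> ('a \<Rightarrow> 'k) \<Rightarrow> 'a \<Rightarrow> 'k" where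
  "coadj m x \<xi> = (\<lambda>y. \<xi> (m x y))"

text \<open>
  For a product \<open>d\<close> on \<open>A\<^sup>*\<close>, the coadjoint action on \<open>A\<^sup>*\<^sup>* = A\<close>: \<open>dual_coadj scale d \<xi> x\<close> is the
  vector representing the functional \<open>\<eta> \<mapsto> \<langle>x, d \<xi> \<eta>\<rangle>\<close>. It exists and is unique in finite dimension, see
  \<open>dual_coadj_eq\<close> below.
\<close>

definition dual_coadj ::
  "('k::field \<Rightarrow> 'a::ab_group_add \<Rightarrow> 'a) \<Rightarrow> (('a \<Rightarrow> 'k) \<Rightarrow> ('a \<Rightarrow> 'k) \<Rightarrow> 'a \<Rightarrow> 'k)
    \<Rightarrow> ('a \<Rightarrow> 'k) \<Rightarrow> 'a \<Rightarrow> 'a" where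
  "dual_coadj scale d \<xi> x = (THE z. \<forall>\<eta>\<in>dual_space scale. \<eta> z = d \<xi> \<eta> x)"


lemma fd_space_basis:
  assumes "fd_space s UNIV"
  obtains B where "finite_dimensional_vector_space s B"
proof -
  from assms obtain S where v: "vector_space s" and S: "finite S" "module.span s S = UNIV"
    unfolding fd_space_def by auto
  interpret vector_space s by (rule v)
  obtain B where B: "B \<subseteq> S" "independent B" "S \<subseteq> span B"
    using maximal_independent_subset[of S] by metis
  have "span B = UNIV"
    using S B(3) span_mono[of S "span B"] by (simp add: span_span top.extremum_unique)
  then have "finite_dimensional_vector_space s B"
    using B S finite_subset by unfold_locales auto
  then show thesis by (rule that)
qed

lemma coordinate_in_dual:
  assumes "finite_dimensional_vector_space s B"
  shows "(\<lambda>x. module.representation s B x b) \<in> dual_space s"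
proof -
  interpret finite_dimensional_vector_space s B by (rule assms)
  show ?thesis
    using linear_representation[OF independent_Basis span_Basis] by (simp add: dual_space_def)
qed

lemma basis_expansion:
  assumes "finite_dimensional_vector_space s B"
  shows "(\<Sum>b\<in>B. s (module.representation s B x b) b) = x"
proof -
  interpret finite_dimensional_vector_space s B by (rule assms)
  show ?thesis
    by (rule sum_representation_eq) (auto simp: independent_Basis span_Basis finite_Basis)
qed

lemma dual_space_add: "\<xi> \<in> dual_space s \<Longrightarrow> \<xi> (x + y) = \<xi> x + \<xi> y"
  and dual_space_scale: "\<xi> \<in> dual_space s \<Longrightarrow> \<xi> (s c x) = c * \<xi> x"
  unfolding dual_space_def
  by (auto dest: Vector_Spaces.linear.axioms(3) simp: module_hom.add module_hom.scale
      linear_def)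

lemma dual_space_zero: "\<xi> \<in> dual_space s \<Longrightarrow> \<xi> 0 = 0"
  using dual_space_add[of \<xi> s 0 0] by (metis add.right_neutral add_cancel_right_right)

lemma dual_space_sum: "\<xi> \<in> dual_space s \<Longrightarrow> \<xi> (sum g I) = (\<Sum>i\<in>I. \<xi> (g i))"
  by (induction I rule: infinite_finite_induct) (auto simp: dual_space_add dual_space_zero)

lemma linear_map_zero:
  assumes "linear_map s UNIV t W f"
  shows "f 0 = 0"
proof -
  have "f (0 + 0) = f 0 + f 0" using assms unfolding linear_map_def by blast
  then show ?thesis by simp
qed

lemma linear_map_sum:
  assumes "linear_map s UNIV t W f"
  shows "f (sum g I) = (\<Sum>i\<in>I. f (g i))"
proof (induction I rule: infinite_finite_induct)
  case (insert i I)
  then show ?case using assms unfolding linear_map_def by simp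
qed (simp_all add: linear_map_zero[OF assms])

text \<open>The canonical map \<open>A \<rightarrow> A\<^sup>*\<^sup>*\<close> is bijective.\<close>

lemma bidual:
  assumes "fd_space s UNIV" and \<Phi>: "linear_map fun_scale (dual_space s) (*) UNIV \<Phi>"
  shows "\<exists>!z. \<forall>\<eta>\<in>dual_space s. \<eta> z = \<Phi> \<eta>"
proof -
  obtain B where B: "finite_dimensional_vector_space s B"
    using fd_space_basis[OF assms(1)] .
  interpret finite_dimensional_vector_space s B by (rule B)
  interpret F: vector_space "fun_scale :: 'a \<Rightarrow> ('b \<Rightarrow> 'a) \<Rightarrow> _"
    by unfold_locales (auto simp: fun_scale_def algebra_simps)
  let ?r = "\<lambda>b x. module.representation s B x b"
  let ?z = "\<Sum>b\<in>B. s (\<Phi> (?r b)) b"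
  have closed_add: "\<xi> + \<eta> \<in> dual_space s" if "\<xi> \<in> dual_space s" "\<eta> \<in> dual_space s" for \<xi> \<eta>
    using that unfolding dual_space_def by (auto simp: Vector_Spaces.linear_iff algebra_simps)
  have closed_scale: "fun_scale c \<xi> \<in> dual_space s" if "\<xi> \<in> dual_space s" for c \<xi>
    using that unfolding dual_space_def
    by (auto simp: Vector_Spaces.linear_iff fun_scale_def algebra_simps)
  have closed_zero: "0 \<in> dual_space s"
    using closed_scale[OF coordinate_in_dual[OF B], of 0] by (simp add: fun_scale_def zero_fun_def)
  have \<Phi>_zero: "\<Phi> 0 = 0"
  proof -
    have "\<Phi> (0 + 0) = \<Phi> 0 + \<Phi> 0" using \<Phi> closed_zero unfolding linear_map_def by blast
    then show ?thesis by (metis add.right_neutral add_cancel_right_right)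
  qed
  have closed_sum: "(\<Sum>b\<in>I. fun_scale (g b) (?r b)) \<in> dual_space s
      \<and> \<Phi> (\<Sum>b\<in>I. fun_scale (g b) (?r b)) = (\<Sum>b\<in>I. g b * \<Phi> (?r b))" for g I
  proof (induction I rule: infinite_finite_induct)
    case (insert b I)
    let ?S = "\<Sum>b\<in>I. fun_scale (g b) (?r b)"
    have r: "fun_scale (g b) (?r b) \<in> dual_space s" "?r b \<in> dual_space s"
      using closed_scale coordinate_in_dual[OF B] by blast+
    have "\<Phi> (fun_scale (g b) (?r b) + ?S) = g b * \<Phi> (?r b) + \<Phi> ?S"
      using \<Phi> r insert.IH unfolding linear_map_def by (simp only: ball_simps)
    then show ?case
      unfolding sum.insert[OF insert.hyps]
      using closed_add[OF r(1) conjunct1[OF insert.IH]] conjunct2[OF insert.IH] by (simp only:)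
  qed (simp_all only: sum.empty sum.infinite closed_zero \<Phi>_zero simp_thms)
  have ex: "\<forall>\<eta>\<in>dual_space s. \<eta> ?z = \<Phi> \<eta>"
  proof
    fix \<eta> assume \<eta>: "\<eta> \<in> dual_space s"
    have app: "(\<Sum>b\<in>I. fun_scale (\<eta> b) (?r b)) x = (\<Sum>b\<in>I. \<eta> b * ?r b x)" for x I
      by (induction I rule: infinite_finite_induct) (auto simp: fun_scale_def)
    have "(\<Sum>b\<in>B. fun_scale (\<eta> b) (?r b)) = \<eta>"
    proof
      fix x
      have "\<eta> x = \<eta> (\<Sum>b\<in>B. s (?r b x) b)" by (simp add: basis_expansion[OF B])
      then show "(\<Sum>b\<in>B. fun_scale (\<eta> b) (?r b)) x = \<eta> x"
        by (simp add: app dual_space_sum[OF \<eta>] dual_space_scale[OF \<eta>] mult.commute)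
    qed
    then have "\<Phi> \<eta> = (\<Sum>b\<in>B. \<eta> b * \<Phi> (?r b))" using closed_sum[of \<eta> B] by simp
    then show "\<eta> ?z = \<Phi> \<eta>"
      by (simp add: dual_space_sum[OF \<eta>] dual_space_scale[OF \<eta>] mult.commute)
  qed
  moreover have "z = ?z" if "\<forall>\<eta>\<in>dual_space s. \<eta> z = \<Phi> \<eta>" for z
  proof -
    have "?r b z = ?r b ?z" for b
      using that ex coordinate_in_dual[OF B, of b] by metis
    then have "(\<Sum>b\<in>B. s (?r b z) b) = (\<Sum>b\<in>B. s (?r b ?z) b)" by simp
    then show ?thesis by (simp only: basis_expansion[OF B])
  qed
  ultimately show ?thesis by blast
qed

lemma dual_coadj_eq:
  assumes "fd_space s UNIV"
    and d: "bilinear_map fun_scale (dual_space s) fun_scale (dual_space s) fun_scale (dual_space s) d"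
    and "\<xi> \<in> dual_space s" "\<eta> \<in> dual_space s"
  shows "\<eta> (dual_coadj s d \<xi> x) = d \<xi> \<eta> x"
proof -
  have "linear_map fun_scale (dual_space s) (*) UNIV (\<lambda>\<eta>. d \<xi> \<eta> x)"
    using d assms(3) unfolding bilinear_map_def linear_map_def by (simp add: fun_scale_def)
  from theI'[OF bidual[OF assms(1) this]] assms(4) show ?thesis
    unfolding dual_coadj_def by blast
qed


section \<open>The tensor square\<close>

text \<open>
  \<open>A \<otimes> A\<close> is modelled inside the dual of the space of bilinear forms on \<open>A\<close>: the pure tensor
  \<open>x \<otimes> y\<close> is evaluation \<open>\<beta> \<mapsto> \<beta> x y\<close>, and \<open>A \<otimes> A\<close> is the span of the pure tensors. As functions are
  total, tensors take the value \<open>0\<close> off the bilinear forms. The universal property is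
  \<open>tensor_universal\<close> below.
\<close>

type_synonym ('a, 'k) tensor2 = "('a \<Rightarrow> 'a \<Rightarrow> 'k) \<Rightarrow> 'k"

definition bilinear_forms :: "('k::field \<Rightarrow> 'a::ab_group_add \<Rightarrow> 'a) \<Rightarrow> ('a \<Rightarrow> 'a \<Rightarrow> 'k) set" where
  "bilinear_forms scale = {\<beta>. bilinear_map scale UNIV scale UNIV (*) UNIV \<beta>}"

definition pure_tensor ::
  "('k::field \<Rightarrow> 'a::ab_group_add \<Rightarrow> 'a) \<Rightarrow> 'a \<Rightarrow> 'a \<Rightarrow> ('a, 'k) tensor2" where
  "pure_tensor scale x y = (\<lambda>\<beta>. if \<beta> \<in> bilinear_forms scale then \<beta> x y else 0)"

definition tensor_space ::
  "('k::field \<Rightarrow> 'a::ab_group_add \<Rightarrow> 'a) \<Rightarrow> ('a, 'k) tensor2 set" where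
  "tensor_space scale = module.span fun_scale {pure_tensor scale x y |x y. True}"

text \<open>
  \<open>f \<otimes> g\<close>, the flip \<open>\<tau>\<close> and the pairing \<open>\<langle>\<xi> \<otimes> \<eta>, T\<rangle>\<close>; their values on pure tensors are computed in
  \<open>tensor_map_pure\<close>, \<open>flip_pure\<close> and \<open>tensor_pairing_pure\<close>.
\<close>

definition tensor_map ::
  "('k::field \<Rightarrow> 'a::ab_group_add \<Rightarrow> 'a) \<Rightarrow> ('a \<Rightarrow> 'a) \<Rightarrow> ('a \<Rightarrow> 'a) \<Rightarrow> ('a, 'k) tensor2
    \<Rightarrow> ('a, 'k) tensor2" where
  "tensor_map scale f g T =
     (\<lambda>\<beta>. if \<beta> \<in> bilinear_forms scale then T (\<lambda>x y. \<beta> (f x) (g y)) else 0)"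

definition flip :: "('a, 'k) tensor2 \<Rightarrow> ('a, 'k) tensor2" where
  "flip T = (\<lambda>\<beta>. T (\<lambda>x y. \<beta> y x))"

definition tensor_pairing ::
  "('a \<Rightarrow> 'k::times) \<Rightarrow> ('a \<Rightarrow> 'k) \<Rightarrow> ('a, 'k) tensor2 \<Rightarrow> 'k" where
  "tensor_pairing \<xi> \<eta> T = T (\<lambda>x y. \<xi> x * \<eta> y)"

lemma tensor_map_pure:
  assumes "linear_map scale UNIV scale UNIV f" "linear_map scale UNIV scale UNIV g"
  shows "tensor_map scale f g (pure_tensor scale x y) = pure_tensor scale (f x) (g y)"
proof
  fix \<beta>
  have "(\<lambda>x y. \<beta> (f x) (g y)) \<in> bilinear_forms scale" if "\<beta> \<in> bilinear_forms scale"
    using that assms unfolding bilinear_forms_def bilinear_map_def linear_map_def by simp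
  then show "tensor_map scale f g (pure_tensor scale x y) \<beta> = pure_tensor scale (f x) (g y) \<beta>"
    by (simp add: tensor_map_def pure_tensor_def)
qed

lemma flip_pure: "flip (pure_tensor scale x y) = pure_tensor scale y x"
proof
  fix \<beta> :: "'a \<Rightarrow> 'a \<Rightarrow> 'b"
  have "(\<lambda>x y. \<beta> y x) \<in> bilinear_forms scale \<longleftrightarrow> \<beta> \<in> bilinear_forms scale"
    unfolding bilinear_forms_def bilinear_map_def by auto
  then show "flip (pure_tensor scale x y) \<beta> = pure_tensor scale y x \<beta>"
    by (simp add: flip_def pure_tensor_def)
qed

lemma tensor_pairing_pure:
  assumes "\<xi> \<in> dual_space scale" "\<eta> \<in> dual_space scale"
  shows "tensor_pairing \<xi> \<eta> (pure_tensor scale x y) = \<xi> x * \<eta> y"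
proof -
  have "(\<lambda>x y. \<xi> x * \<eta> y) \<in> bilinear_forms scale"
    using assms unfolding bilinear_forms_def bilinear_map_def linear_map_def
    by (simp add: dual_space_add dual_space_scale algebra_simps)
  then show ?thesis by (simp add: tensor_pairing_def pure_tensor_def)
qed

lemma pure_tensor_bilinear:
  "bilinear_map scale UNIV scale UNIV fun_scale (tensor_space scale) (pure_tensor scale)"
proof -
  interpret F: vector_space "fun_scale :: 'a \<Rightarrow> ('x \<Rightarrow> 'a) \<Rightarrow> _"
    by unfold_locales (auto simp: fun_scale_def algebra_simps)
  have "pure_tensor scale x y \<in> tensor_space scale" for x y
    unfolding tensor_space_def by (rule F.span_base) blast
  then show ?thesis
    unfolding bilinear_map_def linear_map_def
    by (auto simp: fun_eq_iff pure_tensor_def fun_scale_def bilinear_forms_def bilinear_map_def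
        linear_map_def)
qed

lemma tensor_universal:
  assumes "fd_space scale UNIV" "vector_space t"
    and f: "bilinear_map scale UNIV scale UNIV t UNIV f"
  shows "\<exists>F. linear_map fun_scale (tensor_space scale) t UNIV F \<and>
           (\<forall>x y. F (pure_tensor scale x y) = f x y) \<and>
           (\<forall>G. linear_map fun_scale (tensor_space scale) t UNIV G \<and>
                (\<forall>x y. G (pure_tensor scale x y) = f x y) \<longrightarrow>
                (\<forall>T\<in>tensor_space scale. G T = F T))"
proof -
  obtain B where B: "finite_dimensional_vector_space scale B"
    using fd_space_basis[OF assms(1)] .
  interpret F: vector_space "fun_scale :: 'a \<Rightarrow> ('x \<Rightarrow> 'a) \<Rightarrow> _"
    by unfold_locales (auto simp: fun_scale_def algebra_simps)
  interpret W: vector_space t by (rule assms(2))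
  let ?r = "\<lambda>b x. module.representation scale B x b"
  let ?F = "\<lambda>T. \<Sum>b\<in>B. \<Sum>c\<in>B. t (tensor_pairing (?r b) (?r c) T) (f b c)"
  have lin: "linear_map fun_scale (tensor_space scale) t UNIV ?F"
    unfolding linear_map_def
    by (simp add: tensor_pairing_def fun_scale_def W.scale_left_distrib sum.distrib
        W.scale_sum_right)
  have pure: "?F (pure_tensor scale x y) = f x y" for x y
  proof -
    have l1: "linear_map scale UNIV t UNIV (\<lambda>x. f x y)" for y
      using f unfolding bilinear_map_def by blast
    have l2: "linear_map scale UNIV t UNIV (f x)" for x
      using f unfolding bilinear_map_def by blast
    have s1: "f (scale c x) y = t c (f x y)" for c x y using l1 unfolding linear_map_def by blast
    have s2: "f x (scale c y) = t c (f x y)" for c x y using l2 unfolding linear_map_def by blast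
    have "f x y = f (\<Sum>b\<in>B. scale (?r b x) b) (\<Sum>c\<in>B. scale (?r c y) c)"
      by (simp add: basis_expansion[OF B])
    also have "\<dots> = (\<Sum>b\<in>B. \<Sum>c\<in>B. t (?r b x * ?r c y) (f b c))"
      by (subst linear_map_sum[OF l1]) (simp add: linear_map_sum[OF l2] s1 s2 W.scale_sum_right mult.commute)
    also have "\<dots> = ?F (pure_tensor scale x y)"
      by (simp add: tensor_pairing_pure[OF coordinate_in_dual[OF B] coordinate_in_dual[OF B]])
    finally show ?thesis by simp
  qed
  have uniq: "G T = ?F T"
    if G: "linear_map fun_scale (tensor_space scale) t UNIV G"
      and Gp: "\<And>x y. G (pure_tensor scale x y) = f x y" and T: "T \<in> tensor_space scale" for G T
  proof -
    have sub: "F.subspace (tensor_space scale)" unfolding tensor_space_def by simp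
    have G0: "H 0 = 0" if "linear_map fun_scale (tensor_space scale) t UNIV H" for H
    proof -
      have "H (0 + 0) = H 0 + H 0"
        using that F.subspace_0[OF sub] unfolding linear_map_def by blast
      then show ?thesis by simp
    qed
    have "T \<in> tensor_space scale \<and> G T = ?F T"
      using T[unfolded tensor_space_def]
    proof (induction rule: F.span_induct_alt)
      case base
      show ?case using G0[OF G] G0[OF lin] F.subspace_0[OF sub] by (simp only:)
    next
      case (step c p T)
      then obtain x y where p: "p = pure_tensor scale x y" by blast
      have pT: "p \<in> tensor_space scale"
        using step(1) unfolding tensor_space_def by (rule F.span_base)
      have sT: "fun_scale c p \<in> tensor_space scale" using F.subspace_scale[OF sub pT] .
      have *: "H (fun_scale c p + T) = t c (H p) + H T"
        if "linear_map fun_scale (tensor_space scale) t UNIV H" for H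
        using that pT sT step(2) unfolding linear_map_def by metis
      have "G p = ?F p" using Gp[of x y] pure[of x y] p by (simp only:)
      then show ?case
        using *[OF G] *[OF lin] F.subspace_add[OF sub sT conjunct1[OF step(2)]] conjunct2[OF step(2)]
        by (simp only:)
    qed
    then show ?thesis ..
  qed
  show ?thesis
    by (rule exI[of _ ?F]) (use lin pure uniq in blast)
qed

text \<open>\<open>codual \<Delta> \<xi> \<eta>\<close> is \<open>\<Delta>\<^sup>*(\<xi> \<otimes> \<eta>)\<close>.\<close>

definition codual ::
  "('a \<Rightarrow> ('a, 'k::times) tensor2) \<Rightarrow> ('a \<Rightarrow> 'k) \<Rightarrow> ('a \<Rightarrow> 'k) \<Rightarrow> 'a \<Rightarrow> 'k" where
  "codual \<Delta> \<xi> \<eta> = (\<lambda>x. tensor_pairing \<xi> \<eta> (\<Delta> x))"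


section \<open>Mock-Lie bialgebras and standard Manin triples\<close>

definition coproduct_action ::
  "('k::field \<Rightarrow> 'a::ab_group_add \<Rightarrow> 'a) \<Rightarrow> ('a \<Rightarrow> 'a \<Rightarrow> 'a) \<Rightarrow> 'a \<Rightarrow> ('a, 'k) tensor2
    \<Rightarrow> ('a, 'k) tensor2" where
  "coproduct_action scale m x T = tensor_map scale (m x) id T + tensor_map scale id (m x) T"

definition mock_Lie_bialgebra ::
  "('k::field \<Rightarrow> 'a::ab_group_add \<Rightarrow> 'a) \<Rightarrow> ('a \<Rightarrow> 'a \<Rightarrow> 'a) \<Rightarrow> ('a \<Rightarrow> ('a, 'k) tensor2)
    \<Rightarrow> bool" where
  "mock_Lie_bialgebra scale m \<Delta> \<longleftrightarrow>
     mock_Lie_algebra scale UNIV m \<and>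
     linear_map scale UNIV fun_scale (tensor_space scale) \<Delta> \<and>
     (\<forall>x. flip (\<Delta> x) = \<Delta> x) \<and>
     mock_Lie_algebra fun_scale (dual_space scale) (codual \<Delta>) \<and>
     (\<forall>x y. \<Delta> (m x y) = - coproduct_action scale m x (\<Delta> y) - coproduct_action scale m y (\<Delta> x))"

definition omega_d :: "'a \<times> ('a \<Rightarrow> 'k::plus) \<Rightarrow> 'a \<times> ('a \<Rightarrow> 'k) \<Rightarrow> 'k" where
  "omega_d = (\<lambda>(x, \<xi>) (y, \<eta>). \<eta> x + \<xi> y)"

text \<open>The direct sum \<open>A \<oplus> A\<^sup>*\<close> is \<open>UNIV \<times> dual_space scale\<close>; \<open>x + \<xi>\<close> is the pair \<open>(x, \<xi>)\<close>.\<close>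

definition standard_Manin_triple ::
  "('k::field \<Rightarrow> 'a::ab_group_add \<Rightarrow> 'a) \<Rightarrow> ('a \<Rightarrow> 'a \<Rightarrow> 'a)
    \<Rightarrow> (('a \<Rightarrow> 'k) \<Rightarrow> ('a \<Rightarrow> 'k) \<Rightarrow> 'a \<Rightarrow> 'k) \<Rightarrow> bool" where
  "standard_Manin_triple scale m d \<longleftrightarrow>
     (\<exists>p. mock_Lie_algebra (prod_scale scale fun_scale) (UNIV \<times> dual_space scale) p \<and>
        (\<forall>x y. p (x, 0) (y, 0) = (m x y, 0)) \<and>
        (\<forall>\<xi>\<in>dual_space scale. \<forall>\<eta>\<in>dual_space scale. p (0, \<xi>) (0, \<eta>) = (0, d \<xi> \<eta>)) \<and>
        invariant_form (UNIV \<times> dual_space scale) p omega_d)"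

end

theory Submission
  imports Defs
begin

text \<open>
  Write \<open>\<rho> = L\<^sup>*\<close>, \<open>\<mu>\<close> for the coadjoint action of \<open>A\<^sup>*\<close> on \<open>A\<close>, and \<open>d\<close> for the product of \<open>A\<^sup>*\<close>. Evaluating the
  first mixed condition of a matched pair at a vector \<open>y\<close>, applying a functional \<open>b\<close> to the second, or
  pairing the bialgebra condition with \<open>a \<otimes> b\<close>, one obtains the same scalar identity
  \<open>d a b (x \<bullet> y) + d (\<rho> x a) b y + d a (\<rho> x b) y + d (\<rho> y a) b x + d a (\<rho> y b) x = 0\<close>. As the
  pairings are nondegenerate, this identity is equivalent to each of the three conditions. On the other hand,
  invariance of \<open>\<omega>\<^sub>d\<close> forces the mixed products in \<open>A \<oplus> A\<^sup>*\<close> to be \<open>x \<eta> = \<mu> \<eta> x + \<rho> x \<eta>\<close>, and the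
  mixed components of the mock-Lie identity for that product are the axioms of a matched pair.
\<close>

section \<open>Bicrossed products\<close>

lemma fd_space_vector_space: "fd_space s V \<Longrightarrow> vector_space s"
  by (simp add: fd_space_def)

section \<open>Carriers and bilinear maps on them\<close>

lemma fd_space_zero: "fd_space s V \<Longrightarrow> 0 \<in> V"
  and fd_space_add: "fd_space s V \<Longrightarrow> x \<in> V \<Longrightarrow> y \<in> V \<Longrightarrow> x + y \<in> V"
  and fd_space_scale: "fd_space s V \<Longrightarrow> x \<in> V \<Longrightarrow> s c x \<in> V"
  unfolding fd_space_def module_iff_vector_space[symmetric]
  by (auto intro: module.span_zero module.span_add module.span_scale)

lemma bilinear_map_closed:
  "bilinear_map r U s V t W f \<Longrightarrow> x \<in> U \<Longrightarrow> y \<in> V \<Longrightarrow> f x y \<in> W"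
  and bilinear_map_add_left:
  "bilinear_map r U s V t W f \<Longrightarrow> x \<in> U \<Longrightarrow> x' \<in> U \<Longrightarrow> y \<in> V \<Longrightarrow> f (x + x') y = f x y + f x' y"
  and bilinear_map_add_right:
  "bilinear_map r U s V t W f \<Longrightarrow> x \<in> U \<Longrightarrow> y \<in> V \<Longrightarrow> y' \<in> V \<Longrightarrow> f x (y + y') = f x y + f x y'"
  and bilinear_map_scale_left:
  "bilinear_map r U s V t W f \<Longrightarrow> x \<in> U \<Longrightarrow> y \<in> V \<Longrightarrow> f (r c x) y = t c (f x y)"
  and bilinear_map_scale_right:
  "bilinear_map r U s V t W f \<Longrightarrow> x \<in> U \<Longrightarrow> y \<in> V \<Longrightarrow> f x (s c y) = t c (f x y)"
  unfolding bilinear_map_def linear_map_def by blast+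

lemma bilinear_map_zero:
  assumes "bilinear_map r U s V t W f" "0 \<in> U" "0 \<in> V"
  shows "y \<in> V \<Longrightarrow> f 0 y = 0" and "x \<in> U \<Longrightarrow> f x 0 = 0"
proof -
  show "f 0 y = 0" if "y \<in> V"
    using bilinear_map_add_left[OF assms(1,2,2) that] by simp
  show "f x 0 = 0" if "x \<in> U"
    using bilinear_map_add_right[OF assms(1) that assms(3,3)] by simp
qed

lemma bilinear_mapI:
  assumes "\<And>x y. x \<in> U \<Longrightarrow> y \<in> V \<Longrightarrow> f x y \<in> W"
    and "\<And>x x' y. x \<in> U \<Longrightarrow> x' \<in> U \<Longrightarrow> y \<in> V \<Longrightarrow> f (x + x') y = f x y + f x' y"
    and "\<And>x y y'. x \<in> U \<Longrightarrow> y \<in> V \<Longrightarrow> y' \<in> V \<Longrightarrow> f x (y + y') = f x y + f x y'"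
    and "\<And>c x y. x \<in> U \<Longrightarrow> y \<in> V \<Longrightarrow> f (r c x) y = t c (f x y)"
    and "\<And>c x y. x \<in> U \<Longrightarrow> y \<in> V \<Longrightarrow> f x (s c y) = t c (f x y)"
  shows "bilinear_map r U s V t W f"
  using assms unfolding bilinear_map_def linear_map_def by blast

text \<open>All axioms speak only of values on the carrier, and closure keeps iterated products
  there. This serves to exchange products that agree on a carrier but may differ as total
  functions.\<close>

lemma mock_Lie_algebra_cong:
  assumes "mock_Lie_algebra s V p" and eq: "\<And>x y. x \<in> V \<Longrightarrow> y \<in> V \<Longrightarrow> p x y = q x y"
  shows "mock_Lie_algebra s V q"
proof -
  have fd: "fd_space s V" and p: "bilinear_map s V s V s V p"
    and comm: "\<And>x y. x \<in> V \<Longrightarrow> y \<in> V \<Longrightarrow> p x y = p y x"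
    and jac: "\<And>x y z. x \<in> V \<Longrightarrow> y \<in> V \<Longrightarrow> z \<in> V \<Longrightarrow> p x (p y z) + p y (p z x) + p z (p x y) = 0"
    using assms(1) unfolding mock_Lie_algebra_def by auto
  have cl: "q x y \<in> V" if "x \<in> V" "y \<in> V" for x y
    using bilinear_map_closed[OF p that] eq[OF that] by simp
  have "bilinear_map s V s V s V q"
    by (rule bilinear_mapI)
      (simp_all add: bilinear_map_closed[OF p] fd_space_add[OF fd] fd_space_scale[OF fd] bilinear_map_add_left[OF p]
        bilinear_map_add_right[OF p] bilinear_map_scale_left[OF p] bilinear_map_scale_right[OF p]
        flip: eq)
  moreover have "q x y = q y x" if "x \<in> V" "y \<in> V" for x y
    using comm[OF that] eq that by simp
  moreover have "q x (q y z) + q y (q z x) + q z (q x y) = 0" if "x \<in> V" "y \<in> V" "z \<in> V" for x y z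
    using jac[OF that] that by (simp add: eq cl)
  ultimately show ?thesis using fd unfolding mock_Lie_algebra_def by auto
qed

text \<open>Finite spanning sets \<open>B\<close> and \<open>C\<close> are embedded as
  \<open>(b, 0)\<close> and \<open>(0, c)\<close>; splitting a pair as
  \<open>(x, 0) + (0, y)\<close> shows that their union spans the product.\<close>

lemma fd_space_prod:
  assumes "fd_space s V" "fd_space t W"
  shows "fd_space (prod_scale s t) (V \<times> W)"
proof -
  interpret s: vector_space s by (rule fd_space_vector_space[OF assms(1)])
  interpret t: vector_space t by (rule fd_space_vector_space[OF assms(2)])
  interpret p: vector_space "prod_scale s t"
    by unfold_locales (auto simp: prod_scale_def algebra_simps)
  have scale_pair: "prod_scale s t c (x, y) = (s c x, t c y)" for c x y
    by (simp add: prod_scale_def)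
  obtain B C where B: "finite B" "V = s.span B" and C: "finite C" "W = t.span C"
    using assms unfolding fd_space_def by blast
  let ?S = "(\<lambda>b. (b, 0)) ` B \<union> Pair 0 ` C"
  have 1: "(x, 0) \<in> p.span ?S" if "x \<in> s.span B" for x
    using that
  proof (induction rule: s.span_induct_alt)
    case base
    show ?case using p.span_zero by (simp add: zero_prod_def)
  next
    case (step c b x)
    then have "(b, 0) \<in> p.span ?S" by (intro p.span_base) auto
    from p.span_add[OF p.span_scale[OF this, of c] step(2)] show ?case
      by (simp add: scale_pair)
  qed
  have 2: "(0, y) \<in> p.span ?S" if "y \<in> t.span C" for y
    using that
  proof (induction rule: t.span_induct_alt)
    case base
    show ?case using p.span_zero by (simp add: zero_prod_def)
  next
    case (step c b y)
    then have "(0, b) \<in> p.span ?S" by (intro p.span_base) auto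
    from p.span_add[OF p.span_scale[OF this, of c] step(2)] show ?case
      by (simp add: scale_pair)
  qed
  have "p.span ?S = V \<times> W"
  proof
    have "p.subspace (V \<times> W)"
      by (auto simp: p.subspace_def B C prod_scale_def zero_prod_def s.span_zero t.span_zero
          s.span_add t.span_add s.span_scale t.span_scale)
    moreover have "?S \<subseteq> V \<times> W"
      by (auto simp: B C s.span_zero t.span_zero s.span_base t.span_base)
    ultimately show "p.span ?S \<subseteq> V \<times> W" by (rule p.span_minimal[rotated])
    show "V \<times> W \<subseteq> p.span ?S"
    proof
      fix z assume "z \<in> V \<times> W"
      then have "(fst z, 0) + (0, snd z) \<in> p.span ?S"
        by (intro p.span_add 1 2) (auto simp: B C)
      then show "z \<in> p.span ?S" by simp
    qed
  qed
  then show ?thesis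
    unfolding fd_space_def using p.vector_space_axioms B(1) C(1)
    by (intro conjI exI[of _ ?S]) auto
qed

text \<open>This is the product on a direct sum in which each summand acts on the other: the mixed
  product of \<open>x\<close> and \<open>b\<close> has component \<open>\<mu> b x\<close> in
  \<open>A\<close> and \<open>\<rho> x b\<close> in \<open>H\<close>.\<close>

definition bicrossed_product ::
  "('a::plus \<Rightarrow> 'a \<Rightarrow> 'a) \<Rightarrow> ('h::plus \<Rightarrow> 'h \<Rightarrow> 'h) \<Rightarrow> ('a \<Rightarrow> 'h \<Rightarrow> 'h) \<Rightarrow> ('h \<Rightarrow> 'a \<Rightarrow> 'a)
    \<Rightarrow> 'a \<times> 'h \<Rightarrow> 'a \<times> 'h \<Rightarrow> 'a \<times> 'h" where
  "bicrossed_product m d \<rho> \<mu> =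
     (\<lambda>(x, a) (y, b). (m x y + \<mu> a y + \<mu> b x, d a b + \<rho> x b + \<rho> y a))"

text \<open>The cyclic identity splits according to how many of its three arguments lie in
  \<open>A\<close>. Unmixed triples give the identities of \<open>m\<close> and \<open>d\<close>; a
  mixed triple gives a representation law in one component and a compatibility condition of a
  matched pair in the other.\<close>

lemma mock_Lie_bicrossed_product_iff:
  assumes m: "mock_Lie_algebra s A m" and d: "mock_Lie_algebra t H d"
    and \<rho>: "mock_Lie_representation s A m t H \<rho>" and \<mu>: "mock_Lie_representation t H d s A \<mu>"
  shows "mock_Lie_algebra (prod_scale s t) (A \<times> H) (bicrossed_product m d \<rho> \<mu>)
    \<longleftrightarrow> matched_pair s A m t H d \<rho> \<mu>"
proof -
  have fdA: "fd_space s A" and fdH: "fd_space t H"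
    and bm: "bilinear_map s A s A s A m" and bd: "bilinear_map t H t H t H d"
    and b\<rho>: "bilinear_map s A t H t H \<rho>" and b\<mu>: "bilinear_map t H s A s A \<mu>"
    using assms unfolding mock_Lie_algebra_def mock_Lie_representation_def by auto
  have mc: "m x y = m y x" and mj: "m x (m y z) + m y (m z x) + m z (m x y) = 0"
    if "x \<in> A" "y \<in> A" "z \<in> A" for x y z
    using m that unfolding mock_Lie_algebra_def by auto
  have dc: "d a b = d b a" and dj: "d a (d b c) + d b (d c a) + d c (d a b) = 0"
    if "a \<in> H" "b \<in> H" "c \<in> H" for a b c
    using d that unfolding mock_Lie_algebra_def by auto
  have \<rho>r: "\<rho> (m x y) a + \<rho> x (\<rho> y a) + \<rho> y (\<rho> x a) = 0" if "x \<in> A" "y \<in> A" "a \<in> H" for x y a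
    using \<rho> that unfolding mock_Lie_representation_def by simp
  have \<mu>r: "\<mu> (d a b) x + \<mu> a (\<mu> b x) + \<mu> b (\<mu> a x) = 0" if "x \<in> A" "a \<in> H" "b \<in> H" for x a b
    using \<mu> that unfolding mock_Lie_representation_def by simp
  note cl = bilinear_map_closed[OF bm] bilinear_map_closed[OF bd] bilinear_map_closed[OF b\<rho>]
    bilinear_map_closed[OF b\<mu>] fd_space_add[OF fdA] fd_space_add[OF fdH]
    fd_space_scale[OF fdA] fd_space_scale[OF fdH] fd_space_zero[OF fdA] fd_space_zero[OF fdH]
  note adds = bilinear_map_add_left[OF bm] bilinear_map_add_left[OF bd]
    bilinear_map_add_left[OF b\<rho>] bilinear_map_add_left[OF b\<mu>]
    bilinear_map_add_right[OF bm] bilinear_map_add_right[OF bd]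
    bilinear_map_add_right[OF b\<rho>] bilinear_map_add_right[OF b\<mu>]
  note scales = bilinear_map_scale_left[OF bm] bilinear_map_scale_left[OF bd]
    bilinear_map_scale_left[OF b\<rho>] bilinear_map_scale_left[OF b\<mu>]
    bilinear_map_scale_right[OF bm] bilinear_map_scale_right[OF bd]
    bilinear_map_scale_right[OF b\<rho>] bilinear_map_scale_right[OF b\<mu>]
  note zeros = bilinear_map_zero[OF bm] bilinear_map_zero[OF bd]
    bilinear_map_zero[OF b\<rho>] bilinear_map_zero[OF b\<mu>]
  interpret s: vector_space s by (rule fd_space_vector_space[OF fdA])
  interpret t: vector_space t by (rule fd_space_vector_space[OF fdH])
  let ?p = "bicrossed_product m d \<rho> \<mu>"
  show ?thesis
  proof
    assume L: "mock_Lie_algebra (prod_scale s t) (A \<times> H) ?p"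
    have jac: "?p u (?p v w) + ?p v (?p w u) + ?p w (?p u v) = 0"
      if "u \<in> A \<times> H" "v \<in> A \<times> H" "w \<in> A \<times> H" for u v w
      using L that unfolding mock_Lie_algebra_def by blast
    have "\<rho> x (d a b) + d (\<rho> x a) b + d a (\<rho> x b) + \<rho> (\<mu> a x) b + \<rho> (\<mu> b x) a = 0"
      if "x \<in> A" "a \<in> H" "b \<in> H" for x a b
      \<comment> \<open>One argument from \<open>A\<close> and two from \<open>H\<close>: the
        component in \<open>H\<close> is the first compatibility condition, up to commutativity of
        \<open>d\<close>.\<close>
      using jac[of "(x, 0)" "(0, a)" "(0, b)"] that
      by (simp add: bicrossed_product_def cl zeros zero_prod_def dc[of _ b b] add_ac)
    moreover have "\<mu> a (m x y) + m (\<mu> a x) y + m x (\<mu> a y) + \<mu> (\<rho> x a) y + \<mu> (\<rho> y a) x = 0"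
      if "x \<in> A" "y \<in> A" "a \<in> H" for x y a
      \<comment> \<open>Dually, two arguments from \<open>A\<close> and one from \<open>H\<close>
        give the second condition in the component in \<open>A\<close>.\<close>
      using jac[of "(0, a)" "(x, 0)" "(y, 0)"] that
      by (simp add: bicrossed_product_def cl zeros zero_prod_def mc[of _ y y] add_ac)
    ultimately show "matched_pair s A m t H d \<rho> \<mu>"
      using assms unfolding matched_pair_def by blast
  next
    assume R: "matched_pair s A m t H d \<rho> \<mu>"
    \<comment> \<open>The factors of one product are exchanged in \<open>R1\<close> and in
      \<open>R2\<close>, because the nested bicrossed products below yield each action as the right
      factor.\<close>
    have R1: "\<rho> x (d a b) + d b (\<rho> x a) + d a (\<rho> x b) + \<rho> (\<mu> a x) b + \<rho> (\<mu> b x) a = 0"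
      if "x \<in> A" "a \<in> H" "b \<in> H" for x a b
      using R that dc[of b "\<rho> x a" a] unfolding matched_pair_def by (simp add: cl)
    have R2: "\<mu> a (m x y) + m y (\<mu> a x) + m x (\<mu> a y) + \<mu> (\<rho> x a) y + \<mu> (\<rho> y a) x = 0"
      if "x \<in> A" "y \<in> A" "a \<in> H" for x y a
      using R that mc[of y "\<mu> a x" x] unfolding matched_pair_def by (simp add: cl)
    have bil: "bilinear_map (prod_scale s t) (A \<times> H) (prod_scale s t) (A \<times> H)
        (prod_scale s t) (A \<times> H) ?p"
      by (rule bilinear_mapI)
        (auto simp: bicrossed_product_def cl adds scales prod_scale_def s.scale_right_distrib
          t.scale_right_distrib add_ac)
    have com: "?p u v = ?p v u" if "u \<in> A \<times> H" "v \<in> A \<times> H" for u v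
      using that by (auto simp: bicrossed_product_def mc dc add_ac)
    have jac: "?p (x, a) (?p (y, b) (z, c)) + ?p (y, b) (?p (z, c) (x, a))
        + ?p (z, c) (?p (x, a) (y, b)) = 0"
      if V: "x \<in> A" "y \<in> A" "z \<in> A" "a \<in> H" "b \<in> H" "c \<in> H" for x y z a b c
    proof -
      \<comment> \<open>The summands are grouped by type, each group vanishing by itself: the cyclic
        identity of \<open>m\<close>, three compatibility conditions (two arguments from
        \<open>A\<close>), three representation laws of \<open>\<mu>\<close> (one argument from
        \<open>A\<close>). The second component below has the roles of \<open>A\<close> and
        \<open>H\<close> exchanged.\<close>
      have "fst (?p (x, a) (?p (y, b) (z, c)) + ?p (y, b) (?p (z, c) (x, a))
          + ?p (z, c) (?p (x, a) (y, b)))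
        = (m x (m y z) + m y (m z x) + m z (m x y))
        + (\<mu> a (m y z) + m z (\<mu> a y) + m y (\<mu> a z) + \<mu> (\<rho> y a) z + \<mu> (\<rho> z a) y)
        + (\<mu> b (m z x) + m x (\<mu> b z) + m z (\<mu> b x) + \<mu> (\<rho> z b) x + \<mu> (\<rho> x b) z)
        + (\<mu> c (m x y) + m y (\<mu> c x) + m x (\<mu> c y) + \<mu> (\<rho> x c) y + \<mu> (\<rho> y c) x)
        + (\<mu> (d b c) x + \<mu> b (\<mu> c x) + \<mu> c (\<mu> b x))
        + (\<mu> (d c a) y + \<mu> c (\<mu> a y) + \<mu> a (\<mu> c y))
        + (\<mu> (d a b) z + \<mu> a (\<mu> b z) + \<mu> b (\<mu> a z))"
        using V by (simp add: bicrossed_product_def cl adds add_ac)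
      also have "\<dots> = 0" using V by (simp only: mj R2 \<mu>r add_0_right)
      finally have 1: "fst (?p (x, a) (?p (y, b) (z, c)) + ?p (y, b) (?p (z, c) (x, a))
          + ?p (z, c) (?p (x, a) (y, b))) = 0" .
      have "snd (?p (x, a) (?p (y, b) (z, c)) + ?p (y, b) (?p (z, c) (x, a))
          + ?p (z, c) (?p (x, a) (y, b)))
        = (d a (d b c) + d b (d c a) + d c (d a b))
        + (\<rho> x (d b c) + d c (\<rho> x b) + d b (\<rho> x c) + \<rho> (\<mu> b x) c + \<rho> (\<mu> c x) b)
        + (\<rho> y (d c a) + d a (\<rho> y c) + d c (\<rho> y a) + \<rho> (\<mu> c y) a + \<rho> (\<mu> a y) c)
        + (\<rho> z (d a b) + d b (\<rho> z a) + d a (\<rho> z b) + \<rho> (\<mu> a z) b + \<rho> (\<mu> b z) a)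
        + (\<rho> (m y z) a + \<rho> y (\<rho> z a) + \<rho> z (\<rho> y a))
        + (\<rho> (m z x) b + \<rho> z (\<rho> x b) + \<rho> x (\<rho> z b))
        + (\<rho> (m x y) c + \<rho> x (\<rho> y c) + \<rho> y (\<rho> x c))"
        using V by (simp add: bicrossed_product_def cl adds add_ac)
      also have "\<dots> = 0" using V by (simp only: dj R1 \<rho>r add_0_right)
      finally show ?thesis using 1 by (simp add: prod_eq_iff)
    qed
    have "?p u (?p v w) + ?p v (?p w u) + ?p w (?p u v) = 0"
      if "u \<in> A \<times> H" "v \<in> A \<times> H" "w \<in> A \<times> H" for u v w
      using that jac by (cases u; cases v; cases w) blast
    then show "mock_Lie_algebra (prod_scale s t) (A \<times> H) ?p"
      unfolding mock_Lie_algebra_def using fd_space_prod[OF fdA fdH] bil com by blast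
  qed
qed

section \<open>Coadjoint representations\<close>

lemma dual_space_minus:
  assumes "\<xi> \<in> dual_space s"
  shows "\<xi> (- x) = - \<xi> x"
proof -
  have "\<xi> x + \<xi> (- x) = 0"
    using dual_space_add[OF assms, of x "- x"] dual_space_zero[OF assms] by simp
  then show ?thesis by (rule minus_unique[symmetric])
qed

lemma dual_space_diff:
  assumes "\<xi> \<in> dual_space s"
  shows "\<xi> (x - y) = \<xi> x - \<xi> y"
  using dual_space_add[OF assms, of x "- y"] dual_space_minus[OF assms, of y] by simp

lemma dual_spaceI:
  assumes "vector_space s" "\<And>x y. \<xi> (x + y) = \<xi> x + \<xi> y" "\<And>c x. \<xi> (s c x) = c * \<xi> x"
  shows "\<xi> \<in> dual_space s"
proof -
  have "vector_space ((*) :: 'a \<Rightarrow> 'a \<Rightarrow> 'a)" by unfold_locales (simp_all add: algebra_simps)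
  then show ?thesis
    using assms unfolding dual_space_def Vector_Spaces.linear_iff by blast
qed

text \<open>The coordinate functionals of a basis already determine a vector. Through this,
  equations in \<open>A\<close> involving \<open>dual_coadj\<close> are proved by applying
  functionals.\<close>

lemma dual_space_separates:
  assumes "fd_space s UNIV" and eq: "\<And>\<xi>. \<xi> \<in> dual_space s \<Longrightarrow> \<xi> x = \<xi> y"
  shows "x = y"
proof -
  obtain B where B: "finite_dimensional_vector_space s B"
    using fd_space_basis[OF assms(1)] .
  have "module.representation s B x b = module.representation s B y b" for b
    using eq[OF coordinate_in_dual[OF B, of b]] .
  then have "(\<Sum>b\<in>B. s (module.representation s B x b) b)
      = (\<Sum>b\<in>B. s (module.representation s B y b) b)"
    by (simp only:)
  then show ?thesis by (simp only: basis_expansion[OF B])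
qed

section \<open>The coadjoint actions are representations\<close>

lemma coadj_in_dual:
  assumes "mock_Lie_algebra s UNIV m" "\<xi> \<in> dual_space s"
  shows "coadj m x \<xi> \<in> dual_space s"
proof -
  have fd: "fd_space s UNIV" and bm: "bilinear_map s UNIV s UNIV s UNIV m"
    using assms(1) unfolding mock_Lie_algebra_def by auto
  show ?thesis
    by (rule dual_spaceI[OF fd_space_vector_space[OF fd]])
      (simp_all add: coadj_def bilinear_map_add_right[OF bm] bilinear_map_scale_right[OF bm]
        dual_space_add[OF assms(2)] dual_space_scale[OF assms(2)])
qed

text \<open>By commutativity the mock-Lie identity says that left multiplication is a
  representation. Dualising reverses the order of composition, which is harmless as the
  representation law is symmetric in \<open>x\<close> and \<open>y\<close>.\<close>

lemma coadj_representation: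
  assumes m: "mock_Lie_algebra s UNIV m" and fdH: "fd_space fun_scale (dual_space s)"
  shows "mock_Lie_representation s UNIV m fun_scale (dual_space s) (coadj m)"
proof -
  have bm: "bilinear_map s UNIV s UNIV s UNIV m"
    and mc: "\<And>x y. m x y = m y x" and mj: "\<And>x y z. m x (m y z) + m y (m z x) + m z (m x y) = 0"
    using m unfolding mock_Lie_algebra_def by auto
  have "bilinear_map s UNIV fun_scale (dual_space s) fun_scale (dual_space s) (coadj m)"
    by (rule bilinear_mapI)
      (auto simp: coadj_in_dual[OF m], auto simp: coadj_def fun_scale_def fun_eq_iff
        bilinear_map_add_left[OF bm] bilinear_map_scale_left[OF bm] dual_space_add[where s = s] dual_space_scale[where s = s])
  moreover have "coadj m (m x y) \<xi> = - coadj m x (coadj m y \<xi>) - coadj m y (coadj m x \<xi>)"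
    if \<xi>: "\<xi> \<in> dual_space s" for x y \<xi>
  proof
    fix z
    have "m (m x y) z = - (m x (m y z) + m y (m x z))"
      \<comment> \<open>Two chosen instances of commutativity move \<open>z\<close> to the right in
        every summand.\<close>
      using mj[of x y z] unfolding mc[of z x] mc[of z "m x y"] by (metis minus_unique)
    then show "coadj m (m x y) \<xi> z = (- coadj m x (coadj m y \<xi>) - coadj m y (coadj m x \<xi>)) z"
      by (simp add: coadj_def dual_space_add[OF \<xi>] dual_space_minus[OF \<xi>] del: minus_add_distrib)
  qed
  ultimately show ?thesis using fdH unfolding mock_Lie_representation_def by blast
qed

text \<open>The same argument applies to \<open>d\<close>: after applying a functional
  \<open>c\<close>, \<open>dual_coadj_eq\<close> turns every action on \<open>A\<close> into a
  product in the dual, and the mock-Lie identity of \<open>d\<close> for \<open>a\<close>,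
  \<open>b\<close>, \<open>c\<close>, evaluated at \<open>x\<close>, remains.\<close>

lemma dual_coadj_representation:
  assumes fd: "fd_space s UNIV" and d: "mock_Lie_algebra fun_scale (dual_space s) d"
  shows "mock_Lie_representation fun_scale (dual_space s) d s UNIV (dual_coadj s d)"
proof -
  have fdH: "fd_space fun_scale (dual_space s)"
    and bd: "bilinear_map fun_scale (dual_space s) fun_scale (dual_space s) fun_scale (dual_space s) d"
    and dc: "\<And>a b. a \<in> dual_space s \<Longrightarrow> b \<in> dual_space s \<Longrightarrow> d a b = d b a"
    and dj: "\<And>a b c. a \<in> dual_space s \<Longrightarrow> b \<in> dual_space s \<Longrightarrow> c \<in> dual_space s \<Longrightarrow>
      d a (d b c) + d b (d c a) + d c (d a b) = 0"
    using d unfolding mock_Lie_algebra_def by auto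
  note cl = bilinear_map_closed[OF bd] fd_space_add[OF fdH] fd_space_scale[OF fdH]
  note eq = dual_coadj_eq[OF fd bd]
  have "bilinear_map fun_scale (dual_space s) s UNIV s UNIV (dual_coadj s d)"
  proof (rule bilinear_mapI)
    fix x y a a' assume a: "a \<in> dual_space s" "a' \<in> dual_space s"
    show "dual_coadj s d a x \<in> UNIV" ..
    show "dual_coadj s d (a + a') x = dual_coadj s d a x + dual_coadj s d a' x"
      by (rule dual_space_separates[OF fd])
        (simp add: a eq cl dual_space_add[where s = s] bilinear_map_add_left[OF bd])
    show "dual_coadj s d a (x + y) = dual_coadj s d a x + dual_coadj s d a y"
      by (rule dual_space_separates[OF fd]) (simp add: a eq cl dual_space_add[where s = s])
  next
    fix x a c assume a: "a \<in> dual_space s"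
    show "dual_coadj s d (fun_scale c a) x = s c (dual_coadj s d a x)"
      by (rule dual_space_separates[OF fd])
        (simp add: a eq cl dual_space_scale[where s = s] bilinear_map_scale_left[OF bd], simp add: fun_scale_def)
    show "dual_coadj s d a (s c x) = s c (dual_coadj s d a x)"
      by (rule dual_space_separates[OF fd]) (simp add: a eq cl dual_space_scale[where s = s])
  qed
  moreover have "dual_coadj s d (d a b) x
      = - dual_coadj s d a (dual_coadj s d b x) - dual_coadj s d b (dual_coadj s d a x)"
    if ab: "a \<in> dual_space s" "b \<in> dual_space s" for a b x
  proof (rule dual_space_separates[OF fd])
    fix c assume c: "c \<in> dual_space s"
    have "d a (d b c) x + d b (d a c) x + d (d a b) c x = 0"
      using fun_cong[OF dj[OF ab c], of x] dc[OF ab(1) c] dc[OF cl(1)[OF ab] c] by simp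
    then have "d (d a b) c x = - (d b (d a c) x + d a (d b c) x)"
      by (metis add.commute minus_unique)
    then show "c (dual_coadj s d (d a b) x)
        = c (- dual_coadj s d a (dual_coadj s d b x) - dual_coadj s d b (dual_coadj s d a x))"
      using ab c by (simp add: dual_space_diff[where s = s] dual_space_minus[where s = s] eq cl)
  qed
  ultimately show ?thesis using fd unfolding mock_Lie_representation_def by blast
qed

section \<open>Matched pairs of coadjoint representations and Manin triples\<close>

text \<open>The scalar identity in which the conditions meet. It is phrased without
  \<open>dual_coadj\<close> and without tensors.\<close>

definition coadj_compatible ::
  "('k::field \<Rightarrow> 'a::ab_group_add \<Rightarrow> 'a) \<Rightarrow> ('a \<Rightarrow> 'a \<Rightarrow> 'a)
    \<Rightarrow> (('a \<Rightarrow> 'k) \<Rightarrow> ('a \<Rightarrow> 'k) \<Rightarrow> 'a \<Rightarrow> 'k) \<Rightarrow> bool" where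
  "coadj_compatible s m d \<longleftrightarrow> (\<forall>x y. \<forall>a\<in>dual_space s. \<forall>b\<in>dual_space s.
     d a b (m x y) + d (coadj m x a) b y + d a (coadj m x b) y
       + d (coadj m y a) b x + d a (coadj m y b) x = 0)"

text \<open>For coadjoint actions both compatibility conditions encode one identity: the first, an
  equation between functionals, by evaluation at \<open>y\<close>, and the second, an equation
  between vectors, by applying \<open>b\<close>. The representation axioms hold by the preceding
  section.\<close>

lemma matched_pair_coadj_iff:
  assumes m: "mock_Lie_algebra s UNIV m" and d: "mock_Lie_algebra fun_scale (dual_space s) d"
  shows "matched_pair s UNIV m fun_scale (dual_space s) d (coadj m) (dual_coadj s d)
    \<longleftrightarrow> coadj_compatible s m d"
proof -
  have fd: "fd_space s UNIV" and mc: "\<And>x y. m x y = m y x"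
    using m unfolding mock_Lie_algebra_def by auto
  have fdH: "fd_space fun_scale (dual_space s)"
    and bd: "bilinear_map fun_scale (dual_space s) fun_scale (dual_space s) fun_scale (dual_space s) d"
    and dc: "\<And>a b. a \<in> dual_space s \<Longrightarrow> b \<in> dual_space s \<Longrightarrow> d a b = d b a"
    using d unfolding mock_Lie_algebra_def by auto
  let ?\<rho> = "coadj m" and ?\<mu> = "dual_coadj s d"
  note cl = bilinear_map_closed[OF bd] coadj_in_dual[OF m]
  note eq = dual_coadj_eq[OF fd bd]
  \<comment> \<open>The left side is the functional \<open>?\<rho> y b\<close> at
    \<open>?\<mu> a x\<close>, so the defining property of \<open>dual_coadj\<close>
    applies.\<close>
  have pair: "b (m (?\<mu> a x) y) = d a (?\<rho> y b) x" if "a \<in> dual_space s" "b \<in> dual_space s" for a b x y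
    using eq[OF that(1) coadj_in_dual[OF m that(2)], of y x] by (simp add: coadj_def mc)
  have 1: "(?\<rho> x (d a b) + d (?\<rho> x a) b + d a (?\<rho> x b) + ?\<rho> (?\<mu> a x) b + ?\<rho> (?\<mu> b x) a) y
      = d a b (m x y) + d (?\<rho> x a) b y + d a (?\<rho> x b) y + d (?\<rho> y a) b x + d a (?\<rho> y b) x"
    if ab: "a \<in> dual_space s" "b \<in> dual_space s" for x y a b
    using dc[OF ab(2) coadj_in_dual[OF m ab(1), of y]] pair[OF ab, of x y] pair[OF ab(2,1), of x y]
    \<comment> \<open>Only the outermost coadjoint actions are unfolded; those inside arguments of
      \<open>d\<close> must stay folded to match.\<close>
    by (simp add: coadj_def[of m x "d a b"] coadj_def[of m "dual_coadj s d a x"]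
        coadj_def[of m "dual_coadj s d b x"])
  have 2: "b (?\<mu> a (m x y) + m (?\<mu> a x) y + m x (?\<mu> a y) + ?\<mu> (?\<rho> x a) y + ?\<mu> (?\<rho> y a) x)
      = d a b (m x y) + d (?\<rho> x a) b y + d a (?\<rho> x b) y + d (?\<rho> y a) b x + d a (?\<rho> y b) x"
    if ab: "a \<in> dual_space s" "b \<in> dual_space s" for x y a b
    using ab by (simp add: dual_space_add[where s = s] eq cl pair mc[of x "dual_coadj s d a y"])
  show ?thesis
  proof
    assume "matched_pair s UNIV m fun_scale (dual_space s) d ?\<rho> ?\<mu>"
    then show "coadj_compatible s m d"
      unfolding matched_pair_def coadj_compatible_def using 1 by (metis UNIV_I zero_fun_apply)
  next
    assume C: "coadj_compatible s m d"
    have "?\<rho> x (d a b) + d (?\<rho> x a) b + d a (?\<rho> x b) + ?\<rho> (?\<mu> a x) b + ?\<rho> (?\<mu> b x) a = 0"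
      if "a \<in> dual_space s" "b \<in> dual_space s" for a b x
      by (rule ext) (use C 1[OF that] that in \<open>simp add: coadj_compatible_def\<close>)
    moreover have "?\<mu> a (m x y) + m (?\<mu> a x) y + m x (?\<mu> a y) + ?\<mu> (?\<rho> x a) y + ?\<mu> (?\<rho> y a) x = 0"
      if "a \<in> dual_space s" for a x y
      by (rule dual_space_separates[OF fd])
        (use C 2[OF that] that in \<open>simp add: coadj_compatible_def dual_space_zero[where s = s]\<close>)
    ultimately show "matched_pair s UNIV m fun_scale (dual_space s) d ?\<rho> ?\<mu>"
      unfolding matched_pair_def
      using m d coadj_representation[OF m fdH] dual_coadj_representation[OF fd d] by blast
  qed
qed

text \<open>For \<open>(x, a)\<close>, \<open>(y, b)\<close>, \<open>(z, c)\<close> both sides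
  expand to \<open>c (m x y) + b (m x z) + a (m y z) + d a b z + d a c y + d b c x\<close>, which is
  symmetric in the three pairs.\<close>

lemma invariant_bicrossed_product:
  assumes m: "mock_Lie_algebra s UNIV m" and d: "mock_Lie_algebra fun_scale (dual_space s) d"
  shows "invariant_form (UNIV \<times> dual_space s)
    (bicrossed_product m d (coadj m) (dual_coadj s d)) omega_d"
proof -
  have fd: "fd_space s UNIV" and mc: "\<And>x y. m x y = m y x"
    using m unfolding mock_Lie_algebra_def by auto
  have bd: "bilinear_map fun_scale (dual_space s) fun_scale (dual_space s) fun_scale (dual_space s) d"
    and dc: "\<And>a b. a \<in> dual_space s \<Longrightarrow> b \<in> dual_space s \<Longrightarrow> d a b = d b a"
    using d unfolding mock_Lie_algebra_def by auto
  show ?thesis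
    unfolding invariant_form_def
    by (auto simp: bicrossed_product_def omega_d_def dual_space_add[where s = s] dual_coadj_eq[OF fd bd])
      (simp add: coadj_def mc dc add_ac)
qed

text \<open>Invariance and nondegeneracy determine the mixed products: pairing with
  \<open>(z, 0)\<close> moves the computation into \<open>A\<close> and fixes the functional
  component, pairing with \<open>(0, \<zeta>)\<close> moves it into the dual and fixes the vector
  component. Bilinearity does the rest.\<close>

lemma standard_Manin_triple_product:
  assumes m: "mock_Lie_algebra s UNIV m" and d: "mock_Lie_algebra fun_scale (dual_space s) d"
    and p: "mock_Lie_algebra (prod_scale s fun_scale) (UNIV \<times> dual_space s) p"
    and pA: "\<And>x y. p (x, 0) (y, 0) = (m x y, 0)"
    and pH: "\<And>\<xi> \<eta>. \<xi> \<in> dual_space s \<Longrightarrow> \<eta> \<in> dual_space s \<Longrightarrow> p (0, \<xi>) (0, \<eta>) = (0, d \<xi> \<eta>)"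
    and inv: "invariant_form (UNIV \<times> dual_space s) p omega_d"
    and uv: "u \<in> UNIV \<times> dual_space s" "v \<in> UNIV \<times> dual_space s"
  shows "p u v = bicrossed_product m d (coadj m) (dual_coadj s d) u v"
proof -
  have fd: "fd_space s UNIV"
    using m unfolding mock_Lie_algebra_def by auto
  have fdH: "fd_space fun_scale (dual_space s)"
    and bd: "bilinear_map fun_scale (dual_space s) fun_scale (dual_space s) fun_scale (dual_space s) d"
    using d unfolding mock_Lie_algebra_def by auto
  have bp: "bilinear_map (prod_scale s fun_scale) (UNIV \<times> dual_space s) (prod_scale s fun_scale)
      (UNIV \<times> dual_space s) (prod_scale s fun_scale) (UNIV \<times> dual_space s) p"
    and pc: "\<And>u v. u \<in> UNIV \<times> dual_space s \<Longrightarrow> v \<in> UNIV \<times> dual_space s \<Longrightarrow> p u v = p v u"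
    using p unfolding mock_Lie_algebra_def by blast+
  have H0: "0 \<in> dual_space s" by (rule fd_space_zero[OF fdH])
  have mixed: "p (x, 0) (0, \<eta>) = (dual_coadj s d \<eta> x, coadj m x \<eta>)"
    if \<eta>: "\<eta> \<in> dual_space s" for x \<eta>
  proof -
    obtain a \<alpha> where a: "p (x, 0) (0, \<eta>) = (a, \<alpha>)" by (cases "p (x, 0) (0, \<eta>)")
    have a': "p (0, \<eta>) (x, 0) = (a, \<alpha>)" using pc[of "(x, 0)" "(0, \<eta>)"] a \<eta> H0 by simp
    have "\<alpha> \<in> dual_space s"
      using bilinear_map_closed[OF bp, of "(x, 0)" "(0, \<eta>)"] a \<eta> H0 by simp
    have "\<alpha> z = \<eta> (m x z)" for z
    proof -
      have "omega_d (p (0, \<eta>) (x, 0)) (z, 0) = omega_d (0, \<eta>) (p (x, 0) (z, 0))"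
        using inv \<eta> H0 unfolding invariant_form_def by blast
      then show ?thesis by (simp add: a' pA omega_d_def)
    qed
    moreover have "\<zeta> a = \<zeta> (dual_coadj s d \<eta> x)" if \<zeta>: "\<zeta> \<in> dual_space s" for \<zeta>
    proof -
      have "omega_d (p (x, 0) (0, \<eta>)) (0, \<zeta>) = omega_d (x, 0) (p (0, \<eta>) (0, \<zeta>))"
        using inv \<eta> \<zeta> H0 unfolding invariant_form_def by blast
      then show ?thesis
        using \<open>\<alpha> \<in> _\<close>
        by (simp add: a pH \<eta> \<zeta> omega_d_def dual_coadj_eq[OF fd bd] dual_space_zero[where s = s])
    qed
    then have "a = dual_coadj s d \<eta> x" by (rule dual_space_separates[OF fd])
    ultimately show ?thesis by (simp add: a coadj_def fun_eq_iff)
  qed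
  obtain x \<xi> y \<eta> where u: "u = (x, \<xi>)" and v: "v = (y, \<eta>)" by (cases u; cases v)
  have \<xi>: "\<xi> \<in> dual_space s" and \<eta>: "\<eta> \<in> dual_space s" using uv u v by auto
  have V: "(x, 0) \<in> UNIV \<times> dual_space s" "(0, \<xi>) \<in> UNIV \<times> dual_space s"
    "(y, 0) \<in> UNIV \<times> dual_space s" "(0, \<eta>) \<in> UNIV \<times> dual_space s"
    using \<xi> \<eta> H0 by auto
  have "p u v = p ((x, 0) + (0, \<xi>)) v" by (simp add: u)
  also have "\<dots> = p (x, 0) ((y, 0) + (0, \<eta>)) + p (0, \<xi>) ((y, 0) + (0, \<eta>))"
    by (subst bilinear_map_add_left[OF bp V(1,2) uv(2)]) (simp add: v)
  \<comment> \<open>The third product is commuted into the form that \<open>mixed\<close>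
    covers.\<close>
  also have "\<dots> = p (x, 0) (y, 0) + p (x, 0) (0, \<eta>) + (p (y, 0) (0, \<xi>) + p (0, \<xi>) (0, \<eta>))"
    by (simp only: bilinear_map_add_right[OF bp V(1,3,4)] bilinear_map_add_right[OF bp V(2,3,4)]
        pc[OF V(2,3)])
  also have "\<dots> = bicrossed_product m d (coadj m) (dual_coadj s d) u v"
    by (simp add: pA pH mixed \<xi> \<eta> u v bicrossed_product_def add_ac)
  finally show ?thesis .
qed

text \<open>The bicrossed product is the only candidate for the product on the direct sum, and it is
  always invariant. The remaining question, whether it is mock-Lie, is
  \<open>mock_Lie_bicrossed_product_iff\<close>.\<close>

lemma standard_Manin_triple_iff_matched_pair:
  fixes s :: "'k::field \<Rightarrow> 'a::ab_group_add \<Rightarrow> 'a"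
  assumes m: "mock_Lie_algebra s UNIV m" and d: "mock_Lie_algebra fun_scale (dual_space s) d"
  shows "standard_Manin_triple s m d
    \<longleftrightarrow> matched_pair s UNIV m fun_scale (dual_space s) d (coadj m) (dual_coadj s d)"
proof -
  have fd: "fd_space s UNIV" using m unfolding mock_Lie_algebra_def by auto
  have fdH: "fd_space fun_scale (dual_space s)"
    and bd: "bilinear_map fun_scale (dual_space s) fun_scale (dual_space s) fun_scale (dual_space s) d"
    using d unfolding mock_Lie_algebra_def by auto
  let ?p = "bicrossed_product m d (coadj m) (dual_coadj s d)"
  note \<rho> = coadj_representation[OF m fdH]
  note \<mu> = dual_coadj_representation[OF fd d]
  have b\<rho>: "bilinear_map s UNIV fun_scale (dual_space s) fun_scale (dual_space s) (coadj m)"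
    and b\<mu>: "bilinear_map fun_scale (dual_space s) s UNIV s UNIV (dual_coadj s d)"
    using \<rho> \<mu> unfolding mock_Lie_representation_def by auto
  \<comment> \<open>These vanishing values make the bicrossed product restrict to \<open>m\<close>
    and \<open>d\<close> on the two summands.\<close>
  have z: "dual_coadj s d 0 x = 0" "coadj m x 0 = (0 :: 'a \<Rightarrow> 'k)" "d 0 0 = 0" for x
    using bilinear_map_zero[OF b\<rho>] bilinear_map_zero[OF b\<mu>] bilinear_map_zero[OF bd]
      fd_space_zero[OF fdH] by simp_all
  have z': "dual_coadj s d \<xi> 0 = 0" "coadj m 0 \<xi> = 0" if "\<xi> \<in> dual_space s" for \<xi>
    using bilinear_map_zero[OF b\<rho>] bilinear_map_zero[OF b\<mu>] fd_space_zero[OF fdH] that by simp_all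
  have m0: "m 0 0 = 0"
    using m bilinear_map_zero[of s UNIV s UNIV s UNIV m] unfolding mock_Lie_algebra_def by simp
  have "standard_Manin_triple s m d
      \<longleftrightarrow> mock_Lie_algebra (prod_scale s fun_scale) (UNIV \<times> dual_space s) ?p"
  proof
    assume "standard_Manin_triple s m d"
    then obtain p where p: "mock_Lie_algebra (prod_scale s fun_scale) (UNIV \<times> dual_space s) p"
      "\<And>x y. p (x, 0) (y, 0) = (m x y, 0)"
      "\<And>\<xi> \<eta>. \<xi> \<in> dual_space s \<Longrightarrow> \<eta> \<in> dual_space s \<Longrightarrow> p (0, \<xi>) (0, \<eta>) = (0, d \<xi> \<eta>)"
      "invariant_form (UNIV \<times> dual_space s) p omega_d"
      unfolding standard_Manin_triple_def by blast
    show "mock_Lie_algebra (prod_scale s fun_scale) (UNIV \<times> dual_space s) ?p"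
      by (rule mock_Lie_algebra_cong[OF p(1)]) (rule standard_Manin_triple_product[OF m d p])
  next
    assume p: "mock_Lie_algebra (prod_scale s fun_scale) (UNIV \<times> dual_space s) ?p"
    show "standard_Manin_triple s m d"
      unfolding standard_Manin_triple_def
      by (intro exI[of _ ?p] conjI p invariant_bicrossed_product[OF m d])
        (simp_all add: bicrossed_product_def z z' m0)
  qed
  then show ?thesis using mock_Lie_bicrossed_product_iff[OF m d \<rho> \<mu>] by blast
qed

section \<open>Bialgebras\<close>

lemma vector_space_fun_scale: "vector_space (fun_scale :: 'k::field \<Rightarrow> ('x \<Rightarrow> 'k) \<Rightarrow> _)"
  by unfold_locales (auto simp: fun_scale_def algebra_simps)

text \<open>Span induction with the generators made explicit; membership of \<open>T\<close> is
  carried along so that it is available in the \<open>add\<close> case.\<close>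

lemma tensor_space_induct [consumes 1, case_names zero add]:
  fixes s :: "'k::field \<Rightarrow> 'a::ab_group_add \<Rightarrow> 'a"
  assumes "T \<in> tensor_space s" and "P 0"
    and "\<And>c x y T. T \<in> tensor_space s \<Longrightarrow> P T \<Longrightarrow> P (fun_scale c (pure_tensor s x y) + T)"
  shows "P T"
proof -
  interpret F: vector_space "fun_scale :: 'k \<Rightarrow> ('x \<Rightarrow> 'k) \<Rightarrow> _" by (rule vector_space_fun_scale)
  have "T \<in> tensor_space s \<and> P T"
    using assms(1)[unfolded tensor_space_def]
  proof (induction rule: F.span_induct_alt)
    case base
    show ?case using assms(2) F.span_zero unfolding tensor_space_def by blast
  next
    case (step c p T)
    then obtain x y where "p = pure_tensor s x y" by blast
    moreover have "fun_scale c p + T \<in> tensor_space s"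
      using step unfolding tensor_space_def
      by (blast intro: F.span_add F.span_scale F.span_base)
    ultimately show ?case using assms(3) step by blast
  qed
  then show ?thesis ..
qed

lemma
  fixes s :: "'k::field \<Rightarrow> 'a::ab_group_add \<Rightarrow> 'a"
  shows tensor_space_zero: "0 \<in> tensor_space s"
  and tensor_space_add: "S \<in> tensor_space s \<Longrightarrow> T \<in> tensor_space s \<Longrightarrow> S + T \<in> tensor_space s"
  and tensor_space_diff: "S \<in> tensor_space s \<Longrightarrow> T \<in> tensor_space s \<Longrightarrow> S - T \<in> tensor_space s"
  and tensor_space_minus: "T \<in> tensor_space s \<Longrightarrow> - T \<in> tensor_space s"
  and tensor_space_scale: "T \<in> tensor_space s \<Longrightarrow> fun_scale c T \<in> tensor_space s"
  and tensor_space_pure: "pure_tensor s x y \<in> tensor_space s"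
proof -
  interpret F: vector_space "fun_scale :: 'k \<Rightarrow> ('x \<Rightarrow> 'k) \<Rightarrow> _" by (rule vector_space_fun_scale)
  show "0 \<in> tensor_space s"
    "S \<in> tensor_space s \<Longrightarrow> T \<in> tensor_space s \<Longrightarrow> S + T \<in> tensor_space s"
    "S \<in> tensor_space s \<Longrightarrow> T \<in> tensor_space s \<Longrightarrow> S - T \<in> tensor_space s"
    "T \<in> tensor_space s \<Longrightarrow> - T \<in> tensor_space s"
    "T \<in> tensor_space s \<Longrightarrow> fun_scale c T \<in> tensor_space s"
    unfolding tensor_space_def
    by (rule F.span_zero F.span_add F.span_diff F.span_neg F.span_scale; assumption)+
  show "pure_tensor s x y \<in> tensor_space s"
    unfolding tensor_space_def by (rule F.span_base) auto
qed

text \<open>Tensors are compared by pairings only inside \<open>tensor_space\<close>, so the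
  operations on them must be shown to stay there; \<open>flip\<close> permutes the
  generators.\<close>

lemma flip_in_tensor_space: "T \<in> tensor_space s \<Longrightarrow> flip T \<in> tensor_space s"
proof (induction rule: tensor_space_induct)
  case zero
  show ?case using tensor_space_zero[of s] by (simp add: flip_def zero_fun_def)
next
  case (add c x y T)
  have "flip (fun_scale c S + T) = fun_scale c (flip S) + flip T" for S
    by (simp add: flip_def fun_scale_def fun_eq_iff)
  from this[of "pure_tensor s x y"]
  have "flip (fun_scale c (pure_tensor s x y) + T) = fun_scale c (pure_tensor s y x) + flip T"
    by (simp only: flip_pure)
  then show ?case using add by (simp only: tensor_space_add tensor_space_scale tensor_space_pure)
qed

lemma tensor_map_in_tensor_space:
  assumes f: "linear_map s UNIV s UNIV f" and g: "linear_map s UNIV s UNIV g"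
  shows "T \<in> tensor_space s \<Longrightarrow> tensor_map s f g T \<in> tensor_space s"
proof (induction rule: tensor_space_induct)
  case zero
  have "tensor_map s f g 0 = 0" by (simp add: tensor_map_def fun_eq_iff)
  then show ?case using tensor_space_zero[of s] by (simp only:)
next
  case (add c x y T)
  have "tensor_map s f g (fun_scale c S + T) = fun_scale c (tensor_map s f g S) + tensor_map s f g T"
    for S
    by (simp add: tensor_map_def fun_scale_def fun_eq_iff)
  from this[of "pure_tensor s x y"]
  have "tensor_map s f g (fun_scale c (pure_tensor s x y) + T)
      = fun_scale c (pure_tensor s (f x) (g y)) + tensor_map s f g T"
    by (simp only: tensor_map_pure[OF f g])
  then show ?case using add by (simp only: tensor_space_add tensor_space_scale tensor_space_pure)
qed

text \<open>Both sides are linear in \<open>T\<close>, so pure tensors suffice; there, both factors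
  are expanded in the basis. The coordinates of \<open>T\<close> are thus its pairings with products
  of coordinate functionals.\<close>

lemma tensor_expansion:
  fixes s :: "'k::field \<Rightarrow> 'a::ab_group_add \<Rightarrow> 'a"
  assumes B: "finite_dimensional_vector_space s B" and "T \<in> tensor_space s"
  shows "T = (\<Sum>b\<in>B. \<Sum>c\<in>B. fun_scale (tensor_pairing (\<lambda>x. module.representation s B x b)
    (\<lambda>x. module.representation s B x c) T) (pure_tensor s b c))" (is "T = ?E T")
proof -
  interpret F: vector_space "fun_scale :: 'k \<Rightarrow> ('x \<Rightarrow> 'k) \<Rightarrow> _" by (rule vector_space_fun_scale)
  let ?r = "\<lambda>b x. module.representation s B x b"
  have pure: "?E (pure_tensor s x y) = pure_tensor s x y" for x y
  proof -
    have l1: "linear_map s UNIV fun_scale (tensor_space s) (\<lambda>x. pure_tensor s x y)" for y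
      using pure_tensor_bilinear[of s] unfolding bilinear_map_def by blast
    have l2: "linear_map s UNIV fun_scale (tensor_space s) (pure_tensor s x)" for x
      using pure_tensor_bilinear[of s] unfolding bilinear_map_def by blast
    have "pure_tensor s x y = pure_tensor s (\<Sum>b\<in>B. s (?r b x) b) (\<Sum>c\<in>B. s (?r c y) c)"
      by (simp add: basis_expansion[OF B])
    also have "\<dots> = (\<Sum>b\<in>B. \<Sum>c\<in>B. fun_scale (?r b x * ?r c y) (pure_tensor s b c))"
      by (subst linear_map_sum[OF l1])
        (simp add: linear_map_sum[OF l2] bilinear_map_scale_left[OF pure_tensor_bilinear]
          bilinear_map_scale_right[OF pure_tensor_bilinear] F.scale_sum_right mult.commute)
    also have "\<dots> = ?E (pure_tensor s x y)"
      by (simp add: tensor_pairing_pure[OF coordinate_in_dual[OF B] coordinate_in_dual[OF B]])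
    finally show ?thesis by simp
  qed
  have pairing: "tensor_pairing \<xi> \<eta> (fun_scale a S + T)
      = a * tensor_pairing \<xi> \<eta> S + tensor_pairing \<xi> \<eta> T"
    for \<xi> \<eta> :: "'a \<Rightarrow> 'k" and a and S T :: "('a, 'k) tensor2"
    by (simp add: tensor_pairing_def fun_scale_def)
  show ?thesis
    using assms(2)
  proof (induction rule: tensor_space_induct)
    case zero
    show ?case by (simp add: tensor_pairing_def)
  next
    case (add a x y T)
    have "?E (fun_scale a (pure_tensor s x y) + T) = fun_scale a (?E (pure_tensor s x y)) + ?E T"
      by (simp only: pairing F.scale_left_distrib sum.distrib F.scale_sum_right F.scale_scale)
    then show ?case using add pure by simp
  qed
qed

text \<open>This is nondegeneracy of the pairing on the tensor square: pairings with coordinate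
  functionals are the coefficients in \<open>tensor_expansion\<close>.\<close>

lemma tensor_space_eqI:
  assumes "fd_space s UNIV" "S \<in> tensor_space s" "T \<in> tensor_space s"
    and eq: "\<And>\<xi> \<eta>. \<xi> \<in> dual_space s \<Longrightarrow> \<eta> \<in> dual_space s \<Longrightarrow>
      tensor_pairing \<xi> \<eta> S = tensor_pairing \<xi> \<eta> T"
  shows "S = T"
proof -
  obtain B where B: "finite_dimensional_vector_space s B"
    using fd_space_basis[OF assms(1)] .
  show ?thesis
    using tensor_expansion[OF B assms(2)] tensor_expansion[OF B assms(3)]
      eq[OF coordinate_in_dual[OF B] coordinate_in_dual[OF B]] by simp
qed

text \<open>The coadjoint action is the transpose of left multiplication, applied in one tensor
  factor at a time.\<close>

lemma tensor_pairing_coproduct_action: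
  assumes "\<xi> \<in> dual_space s" "\<eta> \<in> dual_space s"
  shows "tensor_pairing \<xi> \<eta> (coproduct_action s m x T)
    = tensor_pairing (coadj m x \<xi>) \<eta> T + tensor_pairing \<xi> (coadj m x \<eta>) T"
proof -
  \<comment> \<open>This selects the first branch of the conditional in
    \<open>tensor_map\<close>.\<close>
  have "(\<lambda>x y. \<xi> x * \<eta> y) \<in> bilinear_forms s"
    using assms unfolding bilinear_forms_def bilinear_map_def linear_map_def
    by (simp add: dual_space_add[where s = s] dual_space_scale[where s = s] algebra_simps)
  then show ?thesis
    by (simp add: tensor_pairing_def coproduct_action_def tensor_map_def coadj_def)
qed

text \<open>Symmetry of \<open>\<Delta>\<close> and the mock-Lie structure of
  \<open>codual \<Delta>\<close> are inherited from \<open>d\<close>. What remains is the condition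
  on \<open>\<Delta> (m x y)\<close>, which pairing with all \<open>\<xi>\<close>,
  \<open>\<eta>\<close> turns into the scalar identity.\<close>

lemma mock_Lie_bialgebra_iff:
  assumes m: "mock_Lie_algebra s UNIV m" and d: "mock_Lie_algebra fun_scale (dual_space s) d"
    and \<Delta>: "linear_map s UNIV fun_scale (tensor_space s) \<Delta>"
    and d\<Delta>: "\<And>\<xi> \<eta>. \<xi> \<in> dual_space s \<Longrightarrow> \<eta> \<in> dual_space s \<Longrightarrow> d \<xi> \<eta> = codual \<Delta> \<xi> \<eta>"
  shows "mock_Lie_bialgebra s m \<Delta> \<longleftrightarrow> coadj_compatible s m d"
proof -
  have fd: "fd_space s UNIV" and bm: "bilinear_map s UNIV s UNIV s UNIV m"
    using m unfolding mock_Lie_algebra_def by auto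
  have dc: "\<And>a b. a \<in> dual_space s \<Longrightarrow> b \<in> dual_space s \<Longrightarrow> d a b = d b a"
    using d unfolding mock_Lie_algebra_def by auto
  have \<Delta>T: "\<Delta> x \<in> tensor_space s" for x using \<Delta> unfolding linear_map_def by blast
  have pd: "tensor_pairing \<xi> \<eta> (\<Delta> x) = d \<xi> \<eta> x"
    if "\<xi> \<in> dual_space s" "\<eta> \<in> dual_space s" for \<xi> \<eta> x
    using d\<Delta>[OF that] by (simp add: codual_def)
  have lm: "linear_map s UNIV s UNIV (m x)" for x using bm unfolding bilinear_map_def by blast
  have lid: "linear_map s UNIV s UNIV id" unfolding linear_map_def by simp
  have act: "coproduct_action s m x T \<in> tensor_space s" if "T \<in> tensor_space s" for x T
    unfolding coproduct_action_def using that
    by (intro tensor_space_add tensor_map_in_tensor_space lm lid)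
  \<comment> \<open>Under the pairing, \<open>flip\<close> exchanges the two functionals, so this is
    commutativity of \<open>d\<close>.\<close>
  have sym: "flip (\<Delta> x) = \<Delta> x" for x
  proof (rule tensor_space_eqI[OF fd flip_in_tensor_space[OF \<Delta>T] \<Delta>T])
    fix \<xi> \<eta> assume *: "\<xi> \<in> dual_space s" "\<eta> \<in> dual_space s"
    have "tensor_pairing \<xi> \<eta> (flip (\<Delta> x)) = tensor_pairing \<eta> \<xi> (\<Delta> x)"
      by (simp add: tensor_pairing_def flip_def mult.commute)
    then show "tensor_pairing \<xi> \<eta> (flip (\<Delta> x)) = tensor_pairing \<xi> \<eta> (\<Delta> x)"
      using * dc[OF *] by (simp add: pd)
  qed
  have codual: "mock_Lie_algebra fun_scale (dual_space s) (codual \<Delta>)"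
    by (rule mock_Lie_algebra_cong[OF d d\<Delta>])
  let ?R = "\<lambda>x y. - coproduct_action s m x (\<Delta> y) - coproduct_action s m y (\<Delta> x)"
  have R: "tensor_pairing \<xi> \<eta> (?R x y) = - (d (coadj m x \<xi>) \<eta> y + d \<xi> (coadj m x \<eta>) y)
      - (d (coadj m y \<xi>) \<eta> x + d \<xi> (coadj m y \<eta>) x)"
    if "\<xi> \<in> dual_space s" "\<eta> \<in> dual_space s" for \<xi> \<eta> x y
  proof -
    have "tensor_pairing \<xi> \<eta> (?R x y) = - tensor_pairing \<xi> \<eta> (coproduct_action s m x (\<Delta> y))
        - tensor_pairing \<xi> \<eta> (coproduct_action s m y (\<Delta> x))"
      by (simp add: tensor_pairing_def)
    then show ?thesis
      using that by (simp add: tensor_pairing_coproduct_action pd coadj_in_dual[OF m])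
  qed
  \<comment> \<open>Both sides lie in \<open>tensor_space\<close>, so the pairings detect
    equality.\<close>
  have "\<Delta> (m x y) = ?R x y \<longleftrightarrow> (\<forall>\<xi>\<in>dual_space s. \<forall>\<eta>\<in>dual_space s.
      tensor_pairing \<xi> \<eta> (\<Delta> (m x y)) = tensor_pairing \<xi> \<eta> (?R x y))" for x y
    using tensor_space_eqI[OF fd \<Delta>T, of "?R x y" "m x y"] act[OF \<Delta>T]
    by (metis tensor_space_diff tensor_space_minus)
  then have "(\<forall>x y. \<Delta> (m x y) = ?R x y) \<longleftrightarrow> coadj_compatible s m d"
    unfolding coadj_compatible_def
    by (simp add: R pd) (simp add: algebra_simps eq_neg_iff_add_eq_0)
  then show ?thesis
    unfolding mock_Lie_bialgebra_def using m \<Delta> sym codual by blast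
qed

theorem theorem3p8:
  fixes scale :: "'k::field_char_0 \<Rightarrow> 'a::ab_group_add \<Rightarrow> 'a"
    and m :: "'a \<Rightarrow> 'a \<Rightarrow> 'a"
    and d :: "('a \<Rightarrow> 'k) \<Rightarrow> ('a \<Rightarrow> 'k) \<Rightarrow> 'a \<Rightarrow> 'k"
    and \<Delta> :: "'a \<Rightarrow> ('a, 'k) tensor2"
  assumes "mock_Lie_algebra scale UNIV m"
    and "mock_Lie_algebra fun_scale (dual_space scale) d"
    and "linear_map scale UNIV fun_scale (tensor_space scale) \<Delta>"
    and "\<forall>\<xi>\<in>dual_space scale. \<forall>\<eta>\<in>dual_space scale. d \<xi> \<eta> = codual \<Delta> \<xi> \<eta>"
  shows "(standard_Manin_triple scale m d \<longleftrightarrow>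
           matched_pair scale UNIV m fun_scale (dual_space scale) d (coadj m) (dual_coadj scale d)) \<and>
         (matched_pair scale UNIV m fun_scale (dual_space scale) d (coadj m) (dual_coadj scale d) \<longleftrightarrow>
           mock_Lie_bialgebra scale m \<Delta>)"
  \<comment> \<open>The second equivalence passes through \<open>coadj_compatible\<close>.\<close>
  using standard_Manin_triple_iff_matched_pair[OF assms(1,2)] matched_pair_coadj_iff[OF assms(1,2)]
    mock_Lie_bialgebra_iff[OF assms(1,2,3)] assms(4)
  by blast

end
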